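(* Let $H$ be a finite-index subgroup of a finitely generated group $G$. Then the knapsack problem for $G$ is decidable if and only if the knapsack problem for $H$ is decidable.
   Context: For a finitely generated group $K$ with a fixed finite generating set $\Sigma$, elements of $K$ are represented by finite words over $\Sigma\cup\Sigma^{-1}$. The knapsack problem for $K$ is the decision problem: given $g_1,\ldots,g_k,g\in K$ ($k$ is part of the input), decide whether there exist natural numbers $e_1,\ldots,e_k\geq0$ such that $g=g_1^{e_1}\cdots g_k^{e_k}$ in $K$. A finite-index subgroup of a finitely generated group is itself finitely generated. *)

theory Defs
  imports "HOL-Algebra.Coset" "HOL-Algebra.Generated_Groups" "HOL-Library.Nat_Bijection"
begin

section \<open>Partial recursive functions\<close>

datatype recf =
    Zero
  | Succ
  | Proj nat
  | Comp recf "recf list"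
  | PrimRec recf recf
  | Mu recf

text \<open>
  \<open>computes f xs y\<close>: the program \<open>f\<close> halts on the argument tuple \<open>xs\<close> with output \<open>y\<close>.
  Programs carry no arity annotation; on a tuple too short for \<open>f\<close> no rule applies. The recursion and search variables come first in the argument tuple.
\<close>

inductive computes :: "recf \<Rightarrow> nat list \<Rightarrow> nat \<Rightarrow> bool" where
  zero: "computes Zero xs 0"
| succ: "computes Succ [x] (Suc x)"
| proj: "i < length xs \<Longrightarrow> computes (Proj i) xs (xs ! i)"
| comp: "list_all2 (\<lambda>g y. computes g xs y) gs ys \<Longrightarrow> computes f ys z \<Longrightarrow> computes (Comp f gs) xs z"
| primrec_0: "computes f xs y \<Longrightarrow> computes (PrimRec f g) (0 # xs) y"
| primrec_Suc: "computes (PrimRec f g) (n # xs) r \<Longrightarrow> computes g (n # r # xs) y \<Longrightarrow>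
    computes (PrimRec f g) (Suc n # xs) y"
| mu: "computes f (n # xs) 0 \<Longrightarrow> (\<And>m. m < n \<Longrightarrow> \<exists>k. computes f (m # xs) (Suc k)) \<Longrightarrow>
    computes (Mu f) xs n"

lemma computes_functional:
  "computes f xs y \<Longrightarrow> computes f xs z \<Longrightarrow> y = z"
proof (induction arbitrary: z rule: computes.induct)
  case (comp xs gs ys f z')
  from comp.prems obtain ys' where ys': "list_all2 (\<lambda>g y. computes g xs y) gs ys'" "computes f ys' z"
    by (cases rule: computes.cases) auto
  have "ys = ys'"
    using comp.IH(1) ys'(1) by (auto simp: list_all2_conv_all_nth intro!: nth_equalityI)
  with comp.IH(2) ys'(2) show ?case by simp
next
  case (primrec_Suc f g n xs r y)
  from primrec_Suc.prems show ?case
    by (cases rule: computes.cases) (auto dest!: primrec_Suc.IH)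
next
  case (mu f n xs)
  from mu.prems have z: "computes f (z # xs) 0" "\<And>m. m < z \<Longrightarrow> \<exists>k. computes f (m # xs) (Suc k)"
    by (cases rule: computes.cases; auto)+
  have "\<not> n < z" using z(2) mu.IH(1) by blast
  moreover have "\<not> z < n" using mu.IH(2) z(1) by blast
  ultimately show ?case by simp
qed (erule computes.cases; auto)+

text \<open>
  A decision problem consists of a set of inputs \<open>I\<close>, a numerical encoding of the inputs and a
  predicate \<open>P\<close> on inputs. Nothing is required of the program on numbers that encode no input.
\<close>

definition decidable_problem :: "('i \<Rightarrow> nat) \<Rightarrow> 'i set \<Rightarrow> ('i \<Rightarrow> bool) \<Rightarrow> bool" where
  "decidable_problem code I P \<longleftrightarrow>
     (\<exists>f. \<forall>x\<in>I. computes f [code x] (if P x then 1 else 0))"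


section \<open>Words over a finite generating set\<close>

text \<open>A finite generating set is given by an enumeration of it, possibly with repetitions.\<close>

definition generating_list :: "('a, 'b) monoid_scheme \<Rightarrow> 'a list \<Rightarrow> bool" where
  "generating_list K gens \<longleftrightarrow> set gens \<subseteq> carrier K \<and> generate K (set gens) = carrier K"

text \<open>The letter \<open>(i, False)\<close> denotes the \<open>i\<close>-th generator and \<open>(i, True)\<close> its inverse.\<close>

type_synonym word = "(nat \<times> bool) list"

definition words :: "'a list \<Rightarrow> word set" where
  "words gens = lists ({..<length gens} \<times> UNIV)"

definition letter_value :: "('a, 'b) monoid_scheme \<Rightarrow> 'a list \<Rightarrow> nat \<times> bool \<Rightarrow> 'a" where
  "letter_value K gens = (\<lambda>(i, b). if b then inv\<^bsub>K\<^esub> (gens ! i) else gens ! i)"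

definition word_value :: "('a, 'b) monoid_scheme \<Rightarrow> 'a list \<Rightarrow> word \<Rightarrow> 'a" where
  "word_value K gens w = foldr (\<lambda>l x. letter_value K gens l \<otimes>\<^bsub>K\<^esub> x) w \<one>\<^bsub>K\<^esub>"

definition word_code :: "word \<Rightarrow> nat" where
  "word_code w = list_encode (map (\<lambda>(i, b). 2 * i + of_bool b) w)"


section \<open>The knapsack problem\<close>

definition knapsack_solvable :: "('a, 'b) monoid_scheme \<Rightarrow> 'a list \<Rightarrow> 'a \<Rightarrow> bool" where
  "knapsack_solvable K gs g \<longleftrightarrow>
     (\<exists>es :: nat list. length es = length gs \<and>
        g = foldr (\<lambda>x y. x \<otimes>\<^bsub>K\<^esub> y) (map2 (\<lambda>x e. x [^]\<^bsub>K\<^esub> e) gs es) \<one>\<^bsub>K\<^esub>)"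

definition knapsack_code :: "word list \<times> word \<Rightarrow> nat" where
  "knapsack_code = (\<lambda>(ws, w). prod_encode (list_encode (map word_code ws), word_code w))"

definition knapsack_decidable :: "('a, 'b) monoid_scheme \<Rightarrow> 'a list \<Rightarrow> bool" where
  "knapsack_decidable K gens \<longleftrightarrow>
     decidable_problem knapsack_code (lists (words gens) \<times> words gens)
       (\<lambda>(ws, w). knapsack_solvable K (map (word_value K gens) ws) (word_value K gens w))"

end

theory Submission
  imports Defs
begin

text \<open>
  From \<open>G\<close> to \<open>H\<close>: a word over the generators of \<open>H\<close> becomes a word over those of \<open>G\<close> by
  substitution, and solvability does not depend on the ambient group.

  From \<open>H\<close> to \<open>G\<close>: there is \<open>d > 0\<close> with \<open>g\<^sup>d \<in> H\<close> for all \<open>g\<close>. Write every exponent as \<open>d q\<^sub>i + r\<^sub>i\<close>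
  with \<open>r\<^sub>i < d\<close> and put \<open>p\<^sub>i = g\<^sub>1 ^ r\<^sub>1 \<cdots> g\<^sub>i ^ r\<^sub>i\<close>. Moving the \<open>p\<^sub>i\<close> to the right turns \<open>g = \<Prod> g\<^sub>i ^ e\<^sub>i\<close> into
  \<open>g p\<^sub>k\<^sup>-\<^sup>1 = \<Prod> (p\<^sub>i\<^sub>-\<^sub>1 g\<^sub>i\<^sup>d p\<^sub>i\<^sub>-\<^sub>1\<^sup>-\<^sup>1) ^ q\<^sub>i\<close>, which for each of the finitely many choices of the \<open>r\<^sub>i\<close> is a knapsack
  instance over \<open>H\<close> as soon as \<open>g p\<^sub>k\<^sup>-\<^sup>1 \<in> H\<close>. Membership in \<open>H\<close> and the words over the generators
  of \<open>H\<close> are computed by Reidemeister--Schreier rewriting.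
\<close>

section \<open>Computable functions on encoded data\<close>

text \<open>Computability is treated for typed functions, so that programs can be composed by their
  types. Injectivity lets equality of values be tested on codes.\<close>

class encodable =
  fixes enc :: "'a \<Rightarrow> nat"
  assumes inj_enc: "inj enc"

lemma enc_eq_iff: "enc x = enc y \<longleftrightarrow> x = y" for x y :: "'a::encodable"
  by (rule inj_eq[OF inj_enc])

instantiation nat :: encodable
begin
definition enc_nat :: "nat \<Rightarrow> nat" where "enc_nat n = n"
instance by standard (simp add: enc_nat_def inj_def)
end

instantiation bool :: encodable
begin
definition enc_bool :: "bool \<Rightarrow> nat" where "enc_bool b = of_bool b"
instance by standard (simp add: enc_bool_def inj_def)
end

instantiation prod :: (encodable, encodable) encodable
begin
definition enc_prod :: "'a \<times> 'b \<Rightarrow> nat" where "enc_prod p = prod_encode (enc (fst p), enc (snd p))"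
instance by standard (auto simp: enc_prod_def inj_def enc_eq_iff)
end

instantiation list :: (encodable) encodable
begin
definition enc_list :: "'a list \<Rightarrow> nat" where "enc_list xs = list_encode (map enc xs)"
instance by standard (simp add: enc_list_def inj_def list_encode_eq inj_map_eq_map[OF inj_enc])
end

text \<open>Total functions of one argument: several arguments are passed as a tuple. On numbers
  that are no code of an \<open>x\<close> the program is unconstrained.\<close>

definition computable :: "('a::encodable \<Rightarrow> 'b::encodable) \<Rightarrow> bool" where
  "computable f \<longleftrightarrow> (\<exists>p. \<forall>x. computes p [enc x] (enc (f x)))"

section \<open>Programs for arithmetic and pairing\<close>

lemma computes_Comp:
  "length gs = length ys \<Longrightarrow> (\<And>i. i < length gs \<Longrightarrow> computes (gs ! i) xs (ys ! i)) \<Longrightarrow>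
    computes f ys z \<Longrightarrow> computes (Comp f gs) xs z"
  by (rule computes.comp) (auto simp: list_all2_conv_all_nth)

lemma computes_Comp1: "computes g xs y \<Longrightarrow> computes f [y] z \<Longrightarrow> computes (Comp f [g]) xs z"
  by (rule computes_Comp[of _ "[y]"]) auto

lemma computes_Comp2:
  "computes g xs y \<Longrightarrow> computes h xs y' \<Longrightarrow> computes f [y, y'] z \<Longrightarrow> computes (Comp f [g, h]) xs z"
  by (rule computes_Comp[of _ "[y, y']"]) (auto simp: less_Suc_eq)

lemma computes_Proj: "i < length xs \<Longrightarrow> y = xs ! i \<Longrightarrow> computes (Proj i) xs y"
  using computes.proj by simp

lemma computes_const: "\<exists>p. \<forall>xs. computes p xs c"
proof (induction c)
  case (Suc c)
  then obtain p where "\<forall>xs. computes p xs c" ..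
  then have "\<forall>xs. computes (Comp Succ [p]) xs (Suc c)"
    by (blast intro: computes_Comp1 computes.succ)
  then show ?case ..
qed (blast intro: computes.zero)

lemma computes_add: "\<exists>p. \<forall>m n. computes p [m, n] (m + n)"
proof -
  have "computes (PrimRec (Proj 0) (Comp Succ [Proj 1])) [m, n] (m + n)" for m n
    by (induction m) (auto intro!: computes.primrec_0 computes.primrec_Suc computes_Comp1
        computes_Proj computes.succ)
  then show ?thesis by blast
qed

lemma computes_pred: "\<exists>p. \<forall>n. computes p [n] (n - 1)"
proof -
  have "computes (PrimRec Zero (Proj 0)) [n] (n - 1)" for n
  proof (induction n)
    case (Suc n)
    show ?case
      by (rule computes.primrec_Suc[OF Suc computes_Proj]) auto
  qed (simp add: computes.primrec_0 computes.zero)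
  then show ?thesis by blast
qed

text \<open>The subtrahend comes first because it is the recursion variable: it counts how often the
  predecessor is applied to \<open>n\<close>.\<close>

lemma computes_diff: "\<exists>p. \<forall>m n. computes p [m, n] (n - m)"
proof -
  obtain pred where pred: "\<And>n. computes pred [n] (n - 1)"
    using computes_pred by blast
  have "computes (PrimRec (Proj 0) (Comp pred [Proj 1])) [m, n] (n - m)" for m n
  proof (induction m)
    case (Suc m)
    show ?case
      by (rule computes.primrec_Suc[OF Suc], rule computes_Comp1[OF computes_Proj])
        (use pred[of "n - m"] in auto)
  qed (simp add: computes.primrec_0 computes_Proj)
  then show ?thesis by blast
qed

lemma computes_triangle: "\<exists>p. \<forall>n. computes p [n] (triangle n)"
proof -
  obtain add where add: "\<And>m n. computes add [m, n] (m + n)"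
    using computes_add by blast
  have "computes (PrimRec Zero (Comp add [Proj 1, Comp Succ [Proj 0]])) [n] (triangle n)" for n
  proof (induction n)
    case (Suc n)
    show ?case
      unfolding triangle_Suc
      by (rule computes.primrec_Suc[OF Suc], rule computes_Comp2[OF _ _ add])
        (auto intro!: computes_Proj computes_Comp1 computes.succ)
  qed (simp add: computes.primrec_0 computes.zero)
  then show ?thesis by blast
qed

lemma computes_prod_encode: "\<exists>p. \<forall>m n. computes p [m, n] (prod_encode (m, n))"
proof -
  obtain add where add: "\<And>m n. computes add [m, n] (m + n)"
    using computes_add by blast
  obtain tri where tri: "\<And>n. computes tri [n] (triangle n)"
    using computes_triangle by blast
  have "computes (Comp add [Comp tri [add], Proj 0]) [m, n] (prod_encode (m, n))" for m n
    unfolding prod_encode_def prod.case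
    by (rule computes_Comp2[OF computes_Comp1[OF add tri] computes_Proj add]) auto
  then show ?thesis by blast
qed

lemma triangle_mono: "m \<le> n \<Longrightarrow> triangle m \<le> triangle n"
  by (rule lift_Suc_mono_le[of triangle]) auto

text \<open>The sum \<open>m + n\<close> is recovered from \<open>prod_encode (m, n)\<close> as the least \<open>s\<close> with
  \<open>prod_encode (m, n) < triangle (s + 1)\<close>.\<close>

lemma computes_prod_decode:
  "\<exists>p. \<forall>m n. computes p [prod_encode (m, n)] m"
  "\<exists>p. \<forall>m n. computes p [prod_encode (m, n)] n"
proof -
  obtain diff where diff: "\<And>m n. computes diff [m, n] (n - m)"
    using computes_diff by blast
  obtain tri where tri: "\<And>n. computes tri [n] (triangle n)"
    using computes_triangle by blast
  \<comment> \<open>Truncated subtraction of \<open>triangle (Suc s)\<close> from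
    \<open>Suc z\<close> vanishes exactly if \<open>z < triangle (Suc s)\<close>; the successor on
    \<open>z\<close> makes the inequality strict.\<close>
  define test where "test = Comp diff [Comp tri [Comp Succ [Proj 0]], Comp Succ [Proj 1]]"
  have test: "computes test [s, z] (Suc z - triangle (Suc s))" for s z
    unfolding test_def
    by (rule computes_Comp2[OF computes_Comp1[OF _ tri] _ diff])
      (auto intro!: computes_Proj computes_Comp1 computes.succ)
  have sum: "computes (Mu test) [prod_encode (m, n)] (m + n)" for m n
  proof (rule computes.mu)
    show "computes test [m + n, prod_encode (m, n)] 0"
      using test[of "m + n" "prod_encode (m, n)"] by (simp add: prod_encode_def)
    fix k assume "k < m + n"
    then have "triangle (Suc k) \<le> triangle (m + n)"
      by (intro triangle_mono) simp
    then have "Suc (prod_encode (m, n)) - triangle (Suc k) = Suc (prod_encode (m, n) - triangle (Suc k))"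
      by (simp add: prod_encode_def)
    then show "\<exists>r. computes test [k, prod_encode (m, n)] (Suc r)"
      using test by metis
  qed
  have 1: "computes (Comp diff [Comp tri [Mu test], Proj 0]) [prod_encode (m, n)] m" for m n
  proof (rule computes_Comp2[OF computes_Comp1[OF sum tri] computes_Proj])
    show "computes diff [triangle (m + n), prod_encode (m, n)] m"
      using diff[of "triangle (m + n)" "prod_encode (m, n)"] by (simp add: prod_encode_def)
  qed auto
  have 2: "computes (Comp diff [Comp diff [Comp tri [Mu test], Proj 0], Mu test]) [prod_encode (m, n)] n"
    for m n
  proof (rule computes_Comp2[OF 1 sum])
    show "computes diff [m, m + n] n"
      using diff[of m "m + n"] by simp
  qed
  show "\<exists>p. \<forall>m n. computes p [prod_encode (m, n)] m" "\<exists>p. \<forall>m n. computes p [prod_encode (m, n)] n"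
    using 1 2 by blast+
qed

section \<open>Closure properties of computable functions\<close>

named_theorems computable_intros

lemma computable_const [computable_intros]: "computable (\<lambda>_. c)"
  unfolding computable_def using computes_const by blast

lemma computable_id [computable_intros]: "computable (\<lambda>x. x)"
  unfolding computable_def by (rule exI[of _ "Proj 0"]) (simp add: computes_Proj)

lemma computable_compose:
  assumes "computable g" "computable f"
  shows "computable (\<lambda>x. g (f x))"
  using assms unfolding computable_def by (meson computes_Comp1)

text \<open>Numbers are their own codes, so the identity program computes \<open>enc\<close>.
  Together with \<open>computable_via_enc\<close> this moves goals about encoded types to arithmetic
  on codes.\<close>

lemma computable_enc: "computable enc"
  unfolding computable_def enc_nat_def by (rule exI[of _ "Proj 0"]) (simp add: computes_Proj)

lemma computable_via_enc: "computable (\<lambda>x. enc (f x)) \<Longrightarrow> computable f"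
  unfolding computable_def enc_nat_def .

lemma computable_nat2:
  assumes p: "\<exists>p. \<forall>m n. computes p [m, n] (h m n)" and "computable f" "computable g"
  shows "computable (\<lambda>x. h (f x) (g x))"
proof -
  obtain p pf pg where "\<And>m n. computes p [m, n] (h m n)"
    "\<And>x. computes pf [enc x] (f x)" "\<And>x. computes pg [enc x] (g x)"
    using assms unfolding computable_def enc_nat_def by blast
  then have "computes (Comp p [pf, pg]) [enc x] (h (f x) (g x))" for x
    by (blast intro: computes_Comp2)
  then show ?thesis unfolding computable_def enc_nat_def by blast
qed

lemma computable_Suc [computable_intros]: "computable f \<Longrightarrow> computable (\<lambda>x. Suc (f x))"
  by (rule computable_compose[of Suc])
    (simp add: computable_def enc_nat_def exI[of _ Succ] computes.succ)

lemma computable_add [computable_intros]: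
  "computable f \<Longrightarrow> computable g \<Longrightarrow> computable (\<lambda>x. f x + g x :: nat)"
  by (rule computable_nat2[OF computes_add])

lemma computable_diff [computable_intros]:
  "computable f \<Longrightarrow> computable g \<Longrightarrow> computable (\<lambda>x. f x - g x :: nat)"
  by (rule computable_nat2[of "\<lambda>m n. n - m", OF computes_diff])

lemma computable_Pair [computable_intros]:
  assumes "computable f" "computable g"
  shows "computable (\<lambda>x. (f x, g x))"
proof (rule computable_via_enc)
  show "computable (\<lambda>x. enc (f x, g x))"
    unfolding enc_prod_def fst_conv snd_conv
    by (rule computable_nat2[OF computes_prod_encode]; rule computable_compose[OF computable_enc])
      (rule assms)+
qed

lemma computable_fst [computable_intros]: "computable f \<Longrightarrow> computable (\<lambda>x. fst (f x))"
  by (rule computable_compose[of fst], unfold computable_def enc_prod_def)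
    (use computes_prod_decode(1) in blast)

lemma computable_snd [computable_intros]: "computable f \<Longrightarrow> computable (\<lambda>x. snd (f x))"
  by (rule computable_compose[of snd], unfold computable_def enc_prod_def)
    (use computes_prod_decode(2) in blast)

text \<open>Bounded iteration with a parameter \<open>x\<close>; conditionals, folds over lists and
  powers of words are all obtained from it.\<close>

lemma computable_funpow:
  fixes s :: "'a::encodable \<Rightarrow> 'b::encodable \<Rightarrow> 'b"
  assumes "computable n" "computable z" "computable (\<lambda>p. s (fst p) (snd p))"
  shows "computable (\<lambda>x. (s x ^^ n x) (z x))"
proof -
  obtain pn pz ps where pn: "\<And>x. computes pn [enc x] (n x)"
    and pz: "\<And>x. computes pz [enc x] (enc (z x))"
    and ps: "\<And>x y. computes ps [prod_encode (enc x, enc y)] (enc (s x y))"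
    using assms unfolding computable_def enc_nat_def enc_prod_def by auto
  obtain pair where pair: "\<And>m n. computes pair [m, n] (prod_encode (m, n))"
    using computes_prod_encode by blast
  \<comment> \<open>The step program receives the counter, the previous iterate and the parameter;
    \<open>Proj 2\<close> is the parameter and \<open>Proj 1\<close> the iterate.\<close>
  let ?iter = "PrimRec pz (Comp ps [Comp pair [Proj 2, Proj 1]])"
  have "computes ?iter [k, enc x] (enc ((s x ^^ k) (z x)))" for k x
  proof (induction k)
    case (Suc k)
    have "computes ?iter [Suc k, enc x] (enc (s x ((s x ^^ k) (z x))))"
      by (rule computes.primrec_Suc[OF Suc], rule computes_Comp1[OF computes_Comp2[OF _ _ pair] ps])
        (auto intro: computes_Proj)
    then show ?case by simp
  qed (simp add: computes.primrec_0 pz)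
  then have "computes (Comp ?iter [pn, Proj 0]) [enc x] (enc ((s x ^^ n x) (z x)))" for x
    by (auto intro!: computes_Comp2[OF pn] computes_Proj)
  then show ?thesis unfolding computable_def by blast
qed

text \<open>A truth value is encoded as 0 or 1, so iterating the constant map to \<open>f x\<close>
  that many times, starting from \<open>g x\<close>, selects the branch.\<close>

lemma computable_If [computable_intros]:
  assumes "computable b" "computable f" "computable g"
  shows "computable (\<lambda>x. if b x then f x else g x)"
proof -
  have "computable (\<lambda>x. ((\<lambda>_. f x) ^^ enc (b x)) (g x))"
    by (rule computable_funpow computable_compose[OF computable_enc] computable_compose[OF assms(2)]
        computable_intros assms)+
  also have "(\<lambda>x. ((\<lambda>_. f x) ^^ enc (b x)) (g x)) = (\<lambda>x. if b x then f x else g x)"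
    by (auto simp: enc_bool_def)
  finally show ?thesis .
qed

lemma computable_eq [computable_intros]:
  fixes f g :: "'a::encodable \<Rightarrow> 'b::encodable"
  assumes "computable f" "computable g"
  shows "computable (\<lambda>x. f x = g x)"
proof (rule computable_via_enc)
  \<comment> \<open>The sum of both truncated differences is 0 exactly if the codes agree.\<close>
  have "computable (\<lambda>x. 1 - ((enc (f x) - enc (g x)) + (enc (g x) - enc (f x))))"
    by (intro computable_intros computable_compose[OF computable_enc] assms)
  also have "(\<lambda>x. 1 - ((enc (f x) - enc (g x)) + (enc (g x) - enc (f x)))) = (\<lambda>x. enc (f x = g x))"
    by (rule ext) (subst enc_eq_iff[symmetric], simp add: enc_bool_def)
  finally show "computable (\<lambda>x. enc (f x = g x))" .
qed

lemma computable_conj [computable_intros]: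
  assumes "computable f" "computable g"
  shows "computable (\<lambda>x. f x \<and> g x)"
  by (rule back_subst[of computable, OF computable_If[OF assms computable_const[of False]]]) auto

lemma computable_not [computable_intros]: "computable f \<Longrightarrow> computable (\<lambda>x. \<not> f x)"
  by (rule back_subst[of computable, OF computable_If[OF _ computable_const[of False] computable_const[of True]]])
    auto

section \<open>Lists and finite tables\<close>

lemma computable_Cons [computable_intros]:
  assumes "computable f" "computable g"
  shows "computable (\<lambda>x. f x # g x)"
proof (rule computable_via_enc)
  have "computable (\<lambda>x. Suc (enc (f x, g x)))"
    by (intro computable_intros computable_compose[OF computable_enc] assms)
  then show "computable (\<lambda>x. enc (f x # g x))"
    by (simp add: enc_list_def enc_prod_def)
qed

lemma computable_prod_decode:
  "computable (\<lambda>n. fst (prod_decode n))" "computable (\<lambda>n. snd (prod_decode n))"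
  unfolding computable_def enc_nat_def
  using computes_prod_decode by (metis prod.collapse prod_decode_inverse)+

lemma computable_tl [computable_intros]:
  assumes "computable f"
  shows "computable (\<lambda>x. tl (f x))"
proof (rule computable_via_enc)
  have "computable (\<lambda>x. snd (prod_decode (enc (f x) - 1)))"
    by (intro computable_compose[OF computable_prod_decode(2)] computable_intros
        computable_compose[OF computable_enc] assms)
  moreover have "snd (prod_decode (enc xs - 1)) = enc (tl xs)" for xs :: "'b list"
  proof (cases xs)
    case Nil
    \<comment> \<open>The code of \<open>[]\<close> is 0 and \<open>0 - 1 = 0\<close>, so decoding
      yields 0 again, the code of \<open>tl []\<close>.\<close>
    have "prod_decode 0 = (0, 0)"
      using prod_encode_inverse[of "(0, 0)"] by (simp add: prod_encode_def)
    with Nil show ?thesis by (simp add: enc_list_def)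
  qed (simp add: enc_list_def)
  ultimately show "computable (\<lambda>x. enc (tl (f x)))" by simp
qed

text \<open>The code of \<open>hd []\<close> is some unknown number, which a program may contain as a constant.\<close>

lemma computable_hd [computable_intros]:
  assumes "computable f"
  shows "computable (\<lambda>x. hd (f x))"
proof (rule computable_via_enc)
  have "computable (\<lambda>x. if f x = [] then enc (hd [] :: 'b) else fst (prod_decode (enc (f x) - 1)))"
    by (intro computable_compose[OF computable_prod_decode(1)] computable_intros
        computable_compose[OF computable_enc] assms)
  moreover have "(if xs = [] then enc (hd [] :: 'b) else fst (prod_decode (enc xs - 1))) = enc (hd xs)"
    for xs :: "'b list"
    by (cases xs) (auto simp: enc_list_def)
  ultimately show "computable (\<lambda>x. enc (hd (f x)))" by (simp only:)
qed

text \<open>Supplies a computable bound on the number of steps of a loop over a list.\<close>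

lemma length_le_enc: "length xs \<le> enc xs"
  unfolding enc_list_def
  by (induction xs) (auto intro: order_trans[OF _ le_prod_encode_2])

text \<open>The loop state consists of the remaining list and the accumulator. It no longer changes
  once the list is empty, so any number of steps that is at least the length will do.\<close>

lemma computable_foldl:
  assumes "computable l" "computable z"
    and s: "computable (\<lambda>p. s (fst p) (fst (snd p)) (snd (snd p)))"
  shows "computable (\<lambda>x. foldl (s x) (z x) (l x))"
proof -
  define step where "step x la =
    (if fst la = [] then la else (tl (fst la), s x (snd la) (hd (fst la))))" for x la
  have "computable (\<lambda>x. snd ((step x ^^ enc (l x)) (l x, z x)))"
    unfolding step_def
    \<comment> \<open>Instantiated on triples, \<open>s\<close> becomes an introduction rule with
      three computable arguments.\<close>
    by (intro computable_snd[OF computable_funpow] computable_compose[OF computable_enc]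
        computable_If computable_compose[OF s, of "\<lambda>x. (f x, g x, h x)" for f g h, simplified]
        computable_intros assms)
  also have "snd ((step x ^^ n) (xs, a)) = foldl (s x) a xs" if "length xs \<le> n" for x n xs a
    using that
  proof (induction n arbitrary: xs a)
    case (Suc n)
    then show ?case
      by (cases xs) (use Suc.IH[of "[]" a] in \<open>auto simp: funpow_Suc_right step_def simp del: funpow.simps\<close>)
  qed auto
  from this[OF length_le_enc] have "(\<lambda>x. snd ((step x ^^ enc (l x)) (l x, z x))) =
      (\<lambda>x. foldl (s x) (z x) (l x))" by blast
  finally show ?thesis .
qed

lemma computable_rev [computable_intros]:
  assumes "computable f"
  shows "computable (\<lambda>x. rev (f x))"
proof -
  have "computable (\<lambda>x. foldl (\<lambda>ys y. y # ys) [] (f x))"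
    by (intro computable_foldl computable_intros assms)
  then show ?thesis
    by (simp add: foldl_conv_fold fold_Cons_rev)
qed

lemma computable_foldr:
  assumes "computable l" "computable z"
    and s: "computable (\<lambda>p. s (fst p) (fst (snd p)) (snd (snd p)))"
  shows "computable (\<lambda>x. foldr (s x) (l x) (z x))"
  unfolding foldr_conv_foldl
  by (intro computable_foldl computable_intros assms
      computable_compose[OF s, of "\<lambda>x. (f x, g x, h x)" for f g h, simplified])

lemma computable_append [computable_intros]:
  assumes "computable f" "computable g"
  shows "computable (\<lambda>x. f x @ g x)"
proof -
  have "computable (\<lambda>x. foldr (\<lambda>y ys. y # ys) (f x) (g x))"
    by (intro computable_foldr computable_intros assms)
  moreover have "foldr (\<lambda>y ys. y # ys) xs ys = xs @ ys" for xs ys :: "'b list"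
    by (induction xs) auto
  ultimately show ?thesis by simp
qed

lemma computable_concat [computable_intros]:
  assumes "computable f"
  shows "computable (\<lambda>x. concat (f x))"
  unfolding concat_conv_foldr
  by (intro computable_foldr computable_intros assms)

lemma computable_map [computable_intros]:
  assumes "computable l" and g: "computable (\<lambda>p. g (fst p) (snd p))"
  shows "computable (\<lambda>x. map (g x) (l x))"
proof -
  have "computable (\<lambda>x. foldr (\<lambda>y ys. g x y # ys) (l x) [])"
    by (intro computable_foldr computable_intros assms
        computable_compose[OF g, of "\<lambda>x. (f x, h x)" for f h, simplified])
  moreover have "foldr (\<lambda>y ys. g x y # ys) xs [] = map (g x) xs" for x xs
    by (induction xs) auto
  ultimately show ?thesis by simp
qed

lemma computable_filter [computable_intros]:
  assumes "computable l" and g: "computable (\<lambda>p. g (fst p) (snd p))"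
  shows "computable (\<lambda>x. filter (g x) (l x))"
proof -
  have "computable (\<lambda>x. concat (map (\<lambda>y. if g x y then [y] else []) (l x)))"
    by (intro computable_intros assms)
  moreover have "concat (map (\<lambda>y. if g x y then [y] else []) xs) = filter (g x) xs" for x xs
    by (induction xs) auto
  ultimately show ?thesis by simp
qed

lemma computable_bex [computable_intros]:
  assumes "computable l" and g: "computable (\<lambda>p. g (fst p) (snd p))"
  shows "computable (\<lambda>x. \<exists>y\<in>set (l x). g x y)"
proof -
  have "computable (\<lambda>x. \<not> filter (g x) (l x) = [])"
    by (intro computable_intros assms)
  then show ?thesis
    by (simp add: filter_empty_conv)
qed

text \<open>A finite table can be written into a program, however its entries were chosen. This
  makes words obtained by mere existence available to programs.\<close>

lemma computable_finite_support:
  assumes "finite A"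
  shows "computable (\<lambda>x. if x \<in> A then f x else d)"
  using assms
proof induction
  case (insert a A)
  have "computable (\<lambda>x. if x = a then f a else if x \<in> A then f x else d)"
    by (intro computable_intros insert.IH)
  also have "(\<lambda>x. if x = a then f a else if x \<in> A then f x else d) =
      (\<lambda>x. if x \<in> insert a A then f x else d)" by auto
  finally show ?case .
qed (simp add: computable_const)


section \<open>Words and knapsack instances as lists of numbers\<close>

text \<open>The numbering of letters used in \<open>word_code\<close>; it is a bijection onto the
  natural numbers with inverse \<open>code_letter\<close>.\<close>

definition letter_code :: "nat \<times> bool \<Rightarrow> nat" where
  "letter_code = (\<lambda>(i, b). 2 * i + of_bool b)"

definition code_letter :: "nat \<Rightarrow> nat \<times> bool" where
  "code_letter n = (n div 2, odd n)"

lemma code_letter_inverse [simp]: "code_letter (letter_code l) = l"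
  by (cases l) (auto simp: letter_code_def code_letter_def)

lemma letter_code_inverse [simp]: "letter_code (code_letter n) = n"
  by (simp add: letter_code_def code_letter_def of_bool_odd_eq_mod_2)

lemma letter_code_less: "letter_code l < 2 * n \<longleftrightarrow> fst l < n"
  by (cases l) (auto simp: letter_code_def)

text \<open>Words are kept as lists of letter numbers because \<open>enc\<close> on such lists
  agrees with \<open>word_code\<close>, whereas \<open>enc\<close> on pairs numbers letters
  differently.\<close>

definition nat_words :: "'a list \<Rightarrow> nat list set" where
  "nat_words gens = lists {..<2 * length gens}"

definition nat_word_value :: "('a, 'b) monoid_scheme \<Rightarrow> 'a list \<Rightarrow> nat list \<Rightarrow> 'a" where
  "nat_word_value K gens w = word_value K gens (map code_letter w)"

lemma words_eq_image: "words gens = map code_letter ` nat_words gens"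
proof safe
  fix w assume "w \<in> words gens"
  then have "map letter_code w \<in> nat_words gens"
    by (auto simp: words_def nat_words_def lists_eq_set letter_code_less)
  then show "w \<in> map code_letter ` nat_words gens"
    by (rule rev_image_eqI) (simp add: map_idI)
qed (auto simp: words_def nat_words_def lists_eq_set code_letter_def)

lemma word_code_map_code_letter: "word_code (map code_letter w) = enc w"
proof -
  have "word_code v = list_encode (map letter_code v)" for v
    by (simp add: word_code_def letter_code_def)
  then show ?thesis
    by (simp add: enc_list_def enc_nat_def[abs_def] comp_def)
qed

lemma knapsack_code_map_code_letter:
  "knapsack_code (map (map code_letter) ws, map code_letter w) = enc (ws, w)"
  by (simp add: knapsack_code_def word_code_map_code_letter enc_prod_def enc_list_def[of ws] comp_def)

definition nat_knapsack :: "('a, 'b) monoid_scheme \<Rightarrow> 'a list \<Rightarrow> nat list list \<times> nat list \<Rightarrow> bool" where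
  "nat_knapsack K gens = (\<lambda>(ws, w).
     knapsack_solvable K (map (nat_word_value K gens) ws) (nat_word_value K gens w))"

text \<open>Deleting the letters that are out of range turns a program which is only correct on inputs
  into a total one.\<close>

lemma knapsack_decidable_iff:
  "knapsack_decidable K gens \<longleftrightarrow>
     (\<exists>Q. computable Q \<and> (\<forall>ws \<in> lists (nat_words gens). \<forall>w \<in> nat_words gens.
        Q (ws, w) = nat_knapsack K gens (ws, w)))"
    (is "_ \<longleftrightarrow> ?R")
proof -
  let ?dec = "\<lambda>p. \<forall>ws \<in> lists (nat_words gens). \<forall>w \<in> nat_words gens.
    computes p [enc (ws, w)] (enc (nat_knapsack K gens (ws, w)))"
  have "knapsack_decidable K gens \<longleftrightarrow> (\<exists>p. ?dec p)"
    by (simp add: knapsack_decidable_def decidable_problem_def words_eq_image lists_image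
        knapsack_code_map_code_letter nat_knapsack_def nat_word_value_def[abs_def] comp_def
        enc_bool_def of_bool_def)
  also have "\<dots> \<longleftrightarrow> ?R"
  proof
    assume "\<exists>p. ?dec p"
    then obtain p where p: "?dec p" ..
    \<comment> \<open>The condition says \<open>n < 2 * length gens\<close> by means of truncated
      subtraction, which is known to be computable.\<close>
    define san where "san w = filter (\<lambda>n. 2 * length gens - n \<noteq> 0) w" for w
    have "computable (\<lambda>x. (map san (fst x), san (snd x)))"
      unfolding san_def by (intro computable_intros)
    then obtain s where s: "\<And>x. computes s [enc x] (enc (map san (fst x), san (snd x)))"
      unfolding computable_def by blast
    have san_in: "san w \<in> nat_words gens" for w
      by (auto simp: san_def nat_words_def)
    have san_id: "san w = w" if "w \<in> nat_words gens" for w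
      using that by (auto simp: san_def nat_words_def intro!: filter_True)
    define Q where "Q x = nat_knapsack K gens (map san (fst x), san (snd x))" for x
    have "computes (Comp p [s]) [enc x] (enc (Q x))" for x
    proof -
      have "map san (fst x) \<in> lists (nat_words gens)"
        using san_in by auto
      then show ?thesis
        unfolding Q_def using p san_in by (blast intro: computes_Comp1[OF s])
    qed
    moreover have "Q (ws, w) = nat_knapsack K gens (ws, w)"
      if "ws \<in> lists (nat_words gens)" "w \<in> nat_words gens" for ws w
    proof -
      have "map san ws = ws"
        using that(1) by (intro map_idI san_id) auto
      then show ?thesis by (simp add: Q_def san_id that(2))
    qed
    ultimately show ?R unfolding computable_def by blast
  next
    assume ?R
    then obtain Q p where Q: "\<forall>ws \<in> lists (nat_words gens). \<forall>w \<in> nat_words gens.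
        Q (ws, w) = nat_knapsack K gens (ws, w)" and p: "\<forall>x. computes p [enc x] (enc (Q x))"
      unfolding computable_def by blast
    have "?dec p"
    proof (intro ballI)
      fix ws w assume "ws \<in> lists (nat_words gens)" "w \<in> nat_words gens"
      with Q p[rule_format, of "(ws, w)"] show "computes p [enc (ws, w)] (enc (nat_knapsack K gens (ws, w)))"
        by (simp del: in_lists_conv_set)
    qed
    then show "\<exists>p. ?dec p" ..
  qed
  finally show ?thesis .
qed


section \<open>The two reductions\<close>

context monoid
begin

lemma foldr_mult_append:
  "set xs \<subseteq> carrier G \<Longrightarrow> set ys \<subseteq> carrier G \<Longrightarrow>
    foldr (\<otimes>) xs \<one> \<in> carrier G \<and>
    foldr (\<otimes>) (xs @ ys) \<one> = foldr (\<otimes>) xs \<one> \<otimes> foldr (\<otimes>) ys \<one>"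
proof -
  have closed: "foldr (\<otimes>) zs \<one> \<in> carrier G" if "set zs \<subseteq> carrier G" for zs
    using that by (induction zs) auto
  show "set xs \<subseteq> carrier G \<Longrightarrow> set ys \<subseteq> carrier G \<Longrightarrow> ?thesis"
    by (induction xs) (auto simp: m_assoc closed)
qed

lemma knapsack_solvable_Nil [simp]: "knapsack_solvable G [] g \<longleftrightarrow> g = \<one>"
  by (simp add: knapsack_solvable_def)

text \<open>Splits off the last power, which is what inductions along the list of bases from the
  right use.\<close>

lemma knapsack_solvable_snoc:
  assumes "set gs \<subseteq> carrier G" "x \<in> carrier G"
  shows "knapsack_solvable G (gs @ [x]) g \<longleftrightarrow>
    (\<exists>s (e::nat). knapsack_solvable G gs s \<and> g = s \<otimes> x [^] e)"
proof -
  let ?prod = "\<lambda>gs es. foldr (\<otimes>) (map2 (\<lambda>x (e::nat). x [^] e) gs es) \<one>"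
  have snoc: "?prod (gs @ [x]) (es @ [e]) = ?prod gs es \<otimes> x [^] e" if "length es = length gs" for es e
  proof -
    have "set (map2 (\<lambda>x (e::nat). x [^] e) gs es) \<subseteq> carrier G"
      using assms(1) by (auto dest: set_zip_leftD)
    then show ?thesis
      using that assms(2) foldr_mult_append[of "map2 (\<lambda>x (e::nat). x [^] e) gs es" "[x [^] e]"] by simp
  qed
  show ?thesis
  proof
    assume "knapsack_solvable G (gs @ [x]) g"
    then obtain es' where es': "length es' = Suc (length gs)" "g = ?prod (gs @ [x]) es'"
      by (auto simp: knapsack_solvable_def)
    then obtain es e where "es' = es @ [e]" "length es = length gs"
      by (metis length_Suc_conv_rev)
    with es' snoc show "\<exists>s (e::nat). knapsack_solvable G gs s \<and> g = s \<otimes> x [^] e"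
      unfolding knapsack_solvable_def by metis
  next
    assume "\<exists>s (e::nat). knapsack_solvable G gs s \<and> g = s \<otimes> x [^] e"
    then obtain es e where "length es = length gs" "g = ?prod gs es \<otimes> x [^] (e::nat)"
      unfolding knapsack_solvable_def by blast
    then show "knapsack_solvable G (gs @ [x]) g"
      unfolding knapsack_solvable_def using snoc by (intro exI[of _ "es @ [e]"]) simp
  qed
qed

lemma knapsack_solvable_closed:
  assumes "set gs \<subseteq> carrier G" "knapsack_solvable G gs g"
  shows "g \<in> carrier G"
  using assms
  by (induction gs arbitrary: g rule: rev_induct) (auto simp: knapsack_solvable_snoc)

text \<open>Solvability refers only to product, unit and powers, and these are inherited when the
  carrier is replaced.\<close>

lemma knapsack_solvable_consistent:
  "knapsack_solvable (G\<lparr>carrier := H\<rparr>) gs g = knapsack_solvable G gs g"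
  by (simp add: knapsack_solvable_def flip: nat_pow_consistent)

end

section \<open>Values, inverses and powers of words\<close>

lemma nat_word_value_Nil [simp]: "nat_word_value K gens [] = \<one>\<^bsub>K\<^esub>"
  by (simp add: nat_word_value_def word_value_def)

lemma nat_word_value_Cons:
  "nat_word_value K gens (n # w) = letter_value K gens (code_letter n) \<otimes>\<^bsub>K\<^esub> nat_word_value K gens w"
  by (simp add: nat_word_value_def word_value_def)

lemma nat_words_Nil [simp]: "[] \<in> nat_words gens"
  and nat_words_Cons [simp]: "n # w \<in> nat_words gens \<longleftrightarrow> n < 2 * length gens \<and> w \<in> nat_words gens"
  and nat_words_append [simp]: "v @ w \<in> nat_words gens \<longleftrightarrow> v \<in> nat_words gens \<and> w \<in> nat_words gens"
  and nat_words_concat [simp]: "concat vs \<in> nat_words gens \<longleftrightarrow> set vs \<subseteq> nat_words gens"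
  by (auto simp: nat_words_def lists_eq_set)

definition inverse_letter :: "nat \<Rightarrow> nat" where
  "inverse_letter n = (case code_letter n of (i, b) \<Rightarrow> letter_code (i, \<not> b))"

text \<open>The default 0 for letters out of range makes the map on letters a finite table, hence
  computable.\<close>

definition inverse_word :: "'a list \<Rightarrow> nat list \<Rightarrow> nat list" where
  "inverse_word gens w = rev (map (\<lambda>n. if n \<in> {..<2 * length gens} then inverse_letter n else 0) w)"

lemma computable_inverse_word [computable_intros]:
  "computable f \<Longrightarrow> computable (\<lambda>x. inverse_word gens (f x))"
  unfolding inverse_word_def
  by (intro computable_intros computable_compose[OF computable_finite_support]) auto

definition word_power :: "nat \<Rightarrow> nat list \<Rightarrow> nat list" where
  "word_power r w = ((\<lambda>v. w @ v) ^^ r) []"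

lemma computable_word_power [computable_intros]:
  assumes "computable r" "computable f"
  shows "computable (\<lambda>x. word_power (r x) (f x))"
  unfolding word_power_def
  by (intro computable_funpow computable_intros computable_compose[OF assms(2)] assms)

lemma inverse_word_in_nat_words:
  "w \<in> nat_words gens \<Longrightarrow> inverse_word gens w \<in> nat_words gens"
  by (auto simp: inverse_word_def nat_words_def lists_eq_set inverse_letter_def letter_code_less
      code_letter_def)

lemma word_power_in_nat_words:
  "w \<in> nat_words gens \<Longrightarrow> word_power r w \<in> nat_words gens"
  by (induction r) (auto simp: word_power_def)

locale generated_group = group G for G (structure) +
  fixes gens :: "'a list"
  assumes gens: "generating_list G gens"
begin

abbreviation val :: "nat list \<Rightarrow> 'a" where
  "val \<equiv> nat_word_value G gens"

lemma gens_closed: "i < length gens \<Longrightarrow> gens ! i \<in> carrier G"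
  using gens nth_mem unfolding generating_list_def by blast

lemma letter_value_closed: "n < 2 * length gens \<Longrightarrow> letter_value G gens (code_letter n) \<in> carrier G"
  by (simp add: letter_value_def code_letter_def gens_closed)

lemma val_closed [simp]: "w \<in> nat_words gens \<Longrightarrow> val w \<in> carrier G"
  by (induction w) (auto simp: nat_word_value_Cons letter_value_closed)

lemma val_append [simp]:
  "v \<in> nat_words gens \<Longrightarrow> w \<in> nat_words gens \<Longrightarrow> val (v @ w) = val v \<otimes> val w"
  by (induction v) (auto simp: nat_word_value_Cons letter_value_closed m_assoc)

lemma val_inverse_word [simp]: "w \<in> nat_words gens \<Longrightarrow> val (inverse_word gens w) = inv (val w)"
proof (induction w)
  case (Cons n w)
  then have n: "n < 2 * length gens" "w \<in> nat_words gens" by auto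
  have inv: "inverse_letter n < 2 * length gens"
    using n(1) by (auto simp: inverse_letter_def code_letter_def letter_code_less)
  have "letter_value G gens (code_letter (inverse_letter n)) = inv (letter_value G gens (code_letter n))"
    using n(1) gens_closed[of "n div 2"] by (auto simp: inverse_letter_def letter_value_def code_letter_def[of n])
  moreover have "inverse_word gens (n # w) = inverse_word gens w @ [inverse_letter n]"
    using n(1) by (simp add: inverse_word_def)
  ultimately show ?case
    using Cons.IH n inv letter_value_closed[OF n(1)]
    by (simp add: inverse_word_in_nat_words nat_word_value_Cons inv_mult_group)
qed (simp add: inverse_word_def)

lemma val_word_power [simp]: "w \<in> nat_words gens \<Longrightarrow> val (word_power r w) = val w [^] r"
proof (induction r)
  case (Suc r)
  have "val (word_power (Suc r) w) = val w \<otimes> val (word_power r w)"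
    using Suc.prems word_power_in_nat_words[of w gens r] by (simp add: word_power_def)
  also have "\<dots> = val w [^] Suc r"
    unfolding Suc.IH[OF Suc.prems] by (rule nat_pow_Suc2[symmetric]) (simp add: Suc.prems)
  finally show ?case .
qed (simp add: word_power_def)

text \<open>Induction over \<open>generate\<close>: the letter \<open>2 * i\<close> spells the
  generator number \<open>i\<close>, the letter \<open>2 * i + 1\<close> its inverse, and products
  are spelled by concatenation.\<close>

lemma exists_word:
  assumes "g \<in> carrier G"
  shows "\<exists>w\<in>nat_words gens. val w = g"
proof -
  have "g \<in> generate G (set gens)"
    using assms gens by (simp add: generating_list_def)
  then show ?thesis
  proof induction
    case one
    show ?case by (rule bexI[of _ "[]"]) auto
  next
    case (incl h)
    then obtain i where "i < length gens" "h = gens ! i"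
      by (metis in_set_conv_nth)
    then show ?case
      by (intro bexI[of _ "[2 * i]"])
        (auto simp: nat_word_value_Cons letter_value_def code_letter_def gens_closed)
  next
    case (inv h)
    then obtain i where "i < length gens" "h = gens ! i"
      by (metis in_set_conv_nth)
    then show ?case
      by (intro bexI[of _ "[2 * i + 1]"])
        (auto simp: nat_word_value_Cons letter_value_def code_letter_def gens_closed)
  next
    case (eng h1 h2)
    then show ?case by (metis nat_words_append val_append)
  qed
qed

end


text \<open>By the pigeonhole principle two of the cosets of \<open>g\<^sup>0, \<dots>, g\<^sup>N\<close> agree, where \<open>N\<close> is the index of
  \<open>H\<close>. Hence \<open>g\<^sup>k\<close> lies in \<open>H\<close> for some \<open>k\<close> with \<open>0 < k \<le> N\<close>, and \<open>N!\<close> is a uniform exponent.\<close>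

lemma (in group) finite_index_exponent:
  assumes "subgroup H G" "finite (rcosets H)"
  shows "\<exists>d>0. \<forall>g\<in>carrier G. g [^] (d::nat) \<in> H"
proof (intro exI[of _ "fact (card (rcosets H))"] conjI ballI)
  interpret H: subgroup H G by fact
  fix g assume g: "g \<in> carrier G"
  let ?N = "card (rcosets H)" and ?f = "\<lambda>i::nat. H #> g [^] i"
  have "?f ` {..?N} \<subseteq> rcosets H"
    using g by (auto intro!: rcosetsI H.subset)
  then have "card (?f ` {..?N}) \<le> ?N"
    by (rule card_mono[OF assms(2)])
  then have "\<not> inj_on ?f {..?N}"
    by (intro pigeonhole) simp
  then obtain i j where ij: "i < j" "j \<le> ?N" "?f i = ?f j"
    using linorder_inj_onI'[of "{..?N}" ?f] by auto
  have "g [^] j \<in> H #> g [^] i"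
    using ij(3) g assms(1) by (simp add: repr_independenceD)
  then have "g [^] j \<otimes> inv (g [^] i) \<in> H"
    using g by (intro H.rcos_module_imp is_group) auto
  moreover have "g [^] j \<otimes> inv (g [^] i) = g [^] (j - i)"
  proof -
    have "g [^] j = g [^] (j - i) \<otimes> g [^] i"
      using g ij(1) by (simp add: nat_pow_mult)
    then show ?thesis
      using g by (simp add: m_assoc)
  qed
  ultimately have in_H: "g [^] (j - i) \<in> H" by simp
  have "j - i dvd fact ?N"
    using ij(1,2) by (intro dvd_fact) auto
  then obtain k :: nat where k: "fact ?N = (j - i) * k" ..
  have "(g [^] (j - i)) [^] k \<in> H"
    by (induction k) (use in_H in auto)
  then show "g [^] (fact ?N :: nat) \<in> H"
    unfolding k by (simp add: nat_pow_pow[OF g])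
qed simp

text \<open>Adjacent factors \<open>inv p\<close> and \<open>p\<close> cancel. The bracketing to the
  right matches terms normalised by \<open>m_assoc\<close>.\<close>

lemma (in group) conj_pow:
  assumes [simp]: "p \<in> carrier G" "x \<in> carrier G"
  shows "(p \<otimes> (x \<otimes> inv p)) [^] (n::nat) = p \<otimes> (x [^] n \<otimes> inv p)"
proof (induction n)
  case (Suc n)
  have "inv p \<otimes> (p \<otimes> (x \<otimes> inv p)) = x \<otimes> inv p"
    by (simp flip: m_assoc)
  with Suc show ?case by (simp add: m_assoc)
qed simp

section \<open>Splitting exponents by their remainders\<close>

context generated_group
begin

text \<open>Each pair \<open>(hs, p)\<close> stands for a choice of remainders modulo \<open>d\<close> of the exponents of the
  words \<open>g\<^sub>1, \<dots>, g\<^sub>k\<close> processed so far: \<open>p\<close> is the product of the \<open>g\<^sub>i ^ r\<^sub>i\<close>, and \<open>hs\<close>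
  consists of the conjugates of the \<open>g\<^sub>i ^ d\<close> by the partial products.\<close>

definition candidates :: "nat \<Rightarrow> nat list list \<Rightarrow> (nat list list \<times> nat list) list" where
  "candidates d ws = foldl (\<lambda>cs g. concat (map (\<lambda>c. map (\<lambda>r.
     (fst c @ [snd c @ word_power d g @ inverse_word gens (snd c)], snd c @ word_power r g)) [0..<d]) cs))
     [([], [])] ws"

lemma computable_candidates [computable_intros]:
  assumes "computable f"
  shows "computable (\<lambda>x. candidates d (f x))"
  unfolding candidates_def
  by (intro computable_foldl computable_intros assms)

lemma candidates_Nil [simp]: "candidates d [] = [([], [])]"
  by (simp add: candidates_def)

lemma set_candidates_snoc:
  "set (candidates d (ws @ [g])) = (\<Union>(hs, p) \<in> set (candidates d ws).
     (\<lambda>r. (hs @ [p @ word_power d g @ inverse_word gens p], p @ word_power r g)) ` {..<d})"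
  by (auto simp: candidates_def atLeast0LessThan)

lemma candidates_in_nat_words:
  assumes "ws \<in> lists (nat_words gens)" "(hs, p) \<in> set (candidates d ws)"
  shows "hs \<in> lists (nat_words gens)" "p \<in> nat_words gens"
  using assms
  by (induction ws arbitrary: hs p rule: rev_induct)
    (force simp: set_candidates_snoc word_power_in_nat_words inverse_word_in_nat_words)+

text \<open>A conjugate of a \<open>d\<close>-th power is the \<open>d\<close>-th power of a
  conjugate, so it lies in \<open>H\<close> even if \<open>H\<close> is not normal.\<close>

lemma candidates_in_subgroup:
  assumes "ws \<in> lists (nat_words gens)" "(hs, p) \<in> set (candidates d ws)" "h \<in> set hs"
    and H: "\<And>g. g \<in> carrier G \<Longrightarrow> g [^] d \<in> H"
  shows "val h \<in> H"
  using assms(1-3)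
proof (induction ws arbitrary: hs p rule: rev_induct)
  case (snoc g ws)
  then obtain hs' p' r where c: "(hs', p') \<in> set (candidates d ws)"
    and hs: "hs = hs' @ [p' @ word_power d g @ inverse_word gens p']"
    by (auto simp: set_candidates_snoc)
  show ?case
  proof (cases "h \<in> set hs'")
    case True
    with snoc c show ?thesis by auto
  next
    case False
    have "g \<in> nat_words gens" "p' \<in> nat_words gens"
      using snoc.prems candidates_in_nat_words[OF _ c] by auto
    moreover have "h = p' @ word_power d g @ inverse_word gens p'"
      using False hs snoc.prems by auto
    ultimately have "val h = (val p' \<otimes> val g \<otimes> inv (val p')) [^] d"
      by (simp add: word_power_in_nat_words inverse_word_in_nat_words conj_pow m_assoc)
    then show ?thesis
      using H \<open>g \<in> nat_words gens\<close> \<open>p' \<in> nat_words gens\<close> by simp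
  qed
qed simp

text \<open>Induction from the right. A solution is carried as \<open>s \<otimes> val p\<close>,
  with the quotients of the exponents in \<open>s\<close> and their remainders in
  \<open>p\<close>.\<close>

lemma knapsack_solvable_iff_candidates:
  assumes "ws \<in> lists (nat_words gens)" "d > 0"
  shows "knapsack_solvable G (map val ws) y \<longleftrightarrow>
    (\<exists>(hs, p) \<in> set (candidates d ws). \<exists>s. knapsack_solvable G (map val hs) s \<and> y = s \<otimes> val p)"
  using assms(1)
proof (induction ws arbitrary: y rule: rev_induct)
  case (snoc g ws)
  then have ws: "ws \<in> lists (nat_words gens)" and g: "g \<in> nat_words gens" by auto
  note IH = snoc.IH[OF ws]
  \<comment> \<open>Moving \<open>p\<close> to the right: the \<open>inv p\<close> closing the
    conjugate cancels against the \<open>p\<close> of the remainder part, and the powers of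
    \<open>x\<close> merge.\<close>
  have split: "s \<otimes> (p \<otimes> (x [^] d \<otimes> inv p)) [^] q \<otimes> (p \<otimes> x [^] r) = s \<otimes> p \<otimes> x [^] (d * q + r)"
    if [simp]: "s \<in> carrier G" "p \<in> carrier G" "x \<in> carrier G" for s p x and q r :: nat
  proof -
    have cancel: "inv p \<otimes> (p \<otimes> x [^] r) = x [^] r"
      by (simp flip: m_assoc)
    have "(p \<otimes> (x [^] d \<otimes> inv p)) [^] q = p \<otimes> (x [^] (d * q) \<otimes> inv p)"
      by (simp add: conj_pow nat_pow_pow)
    moreover have "x [^] (d * q + r) = x [^] (d * q) \<otimes> x [^] r"
      by (simp add: nat_pow_mult)
    ultimately show ?thesis
      by (simp add: m_assoc cancel)
  qed
  have snoc_iff: "knapsack_solvable G (map val (hs @ [p @ word_power d g @ inverse_word gens p])) t \<longleftrightarrow>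
      (\<exists>s q. knapsack_solvable G (map val hs) s \<and> t = s \<otimes> (val p \<otimes> (val g [^] d \<otimes> inv (val p))) [^] (q::nat))"
    and closed: "knapsack_solvable G (map val hs) t \<Longrightarrow> t \<in> carrier G" "val p \<in> carrier G"
    and val_p: "val (p @ word_power r g) = val p \<otimes> val g [^] r"
    if "(hs, p) \<in> set (candidates d ws)" for hs p t r
  proof -
    have hs: "set (map val hs) \<subseteq> carrier G" and p: "p \<in> nat_words gens"
      using candidates_in_nat_words[OF ws that] by auto
    show "knapsack_solvable G (map val hs) t \<Longrightarrow> t \<in> carrier G" "val p \<in> carrier G"
      using knapsack_solvable_closed[OF hs] p by auto
    show "val (p @ word_power r g) = val p \<otimes> val g [^] r"
      using p g by (simp add: word_power_in_nat_words)
    show "knapsack_solvable G (map val (hs @ [p @ word_power d g @ inverse_word gens p])) t \<longleftrightarrow>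
      (\<exists>s q. knapsack_solvable G (map val hs) s \<and> t = s \<otimes> (val p \<otimes> (val g [^] d \<otimes> inv (val p))) [^] (q::nat))"
      using p g hs
      by (simp add: knapsack_solvable_snoc word_power_in_nat_words inverse_word_in_nat_words m_assoc)
  qed
  have "knapsack_solvable G (map val (ws @ [g])) y \<longleftrightarrow>
      (\<exists>t (e::nat). knapsack_solvable G (map val ws) t \<and> y = t \<otimes> val g [^] e)"
  proof -
    have "set (map val ws) \<subseteq> carrier G"
      using ws by auto
    then show ?thesis
      using g by (simp add: knapsack_solvable_snoc)
  qed
  also have "\<dots> \<longleftrightarrow> (\<exists>(hs, p) \<in> set (candidates d ws). \<exists>s (e::nat).
      knapsack_solvable G (map val hs) s \<and> y = s \<otimes> val p \<otimes> val g [^] e)"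
    unfolding IH by blast
  \<comment> \<open>The exponent \<open>e\<close> is divided by \<open>d\<close>: the quotient
    becomes the exponent of the new conjugate inside \<open>t\<close>, the remainder
    \<open>r\<close> extends \<open>p\<close>.\<close>
  also have "\<dots> \<longleftrightarrow> (\<exists>(hs, p) \<in> set (candidates d ws). \<exists>r<d. \<exists>t.
      knapsack_solvable G (map val (hs @ [p @ word_power d g @ inverse_word gens p])) t \<and>
      y = t \<otimes> val (p @ word_power r g))"
  proof (rule bex_cong[OF refl], clarify)
    fix hs p assume c: "(hs, p) \<in> set (candidates d ws)"
    have split': "s \<otimes> (val p \<otimes> (val g [^] d \<otimes> inv (val p))) [^] q \<otimes> (val p \<otimes> val g [^] r) =
        s \<otimes> val p \<otimes> val g [^] (d * q + r)"
      if "knapsack_solvable G (map val hs) s" for s and q r :: nat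
      using closed[OF c] that g by (intro split) auto
    show "(\<exists>s (e::nat). knapsack_solvable G (map val hs) s \<and> y = s \<otimes> val p \<otimes> val g [^] e) \<longleftrightarrow>
      (\<exists>r<d. \<exists>t. knapsack_solvable G (map val (hs @ [p @ word_power d g @ inverse_word gens p])) t \<and>
        y = t \<otimes> val (p @ word_power r g))" (is "?L \<longleftrightarrow> ?R")
      unfolding snoc_iff[OF c] val_p[OF c]
    proof (intro iffI; elim exE conjE)
      fix s and e :: nat
      assume s: "knapsack_solvable G (map val hs) s" and "y = s \<otimes> val p \<otimes> val g [^] e"
      then have "y = s \<otimes> (val p \<otimes> (val g [^] d \<otimes> inv (val p))) [^] (e div d) \<otimes>
          (val p \<otimes> val g [^] (e mod d))"
        by (simp add: split'[OF s])
      with s \<open>d > 0\<close> show "\<exists>r<d. \<exists>t. (\<exists>s (q::nat). knapsack_solvable G (map val hs) s \<and>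
          t = s \<otimes> (val p \<otimes> (val g [^] d \<otimes> inv (val p))) [^] q) \<and> y = t \<otimes> (val p \<otimes> val g [^] r)"
        by (intro exI[of _ "e mod d"]) auto
    next
      fix r :: nat and t s and q :: nat
      assume "knapsack_solvable G (map val hs) s"
        "y = t \<otimes> (val p \<otimes> val g [^] r)" "t = s \<otimes> (val p \<otimes> (val g [^] d \<otimes> inv (val p))) [^] q"
      then show "\<exists>s (e::nat). knapsack_solvable G (map val hs) s \<and> y = s \<otimes> val p \<otimes> val g [^] e"
        by (intro exI[of _ s] exI[of _ "d * q + r"]) (simp add: split')
    qed
  qed
  also have "\<dots> \<longleftrightarrow> (\<exists>(hs, p) \<in> set (candidates d (ws @ [g])). \<exists>s.
      knapsack_solvable G (map val hs) s \<and> y = s \<otimes> val p)"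
    by (simp only: set_candidates_snoc case_prod_unfold bex_UN bex_simps fst_conv snd_conv)
      (simp only: Bex_def lessThan_iff)
  finally show ?case .
qed simp


text \<open>Reidemeister--Schreier rewriting: reading the letter \<open>n\<close> in the coset \<open>C\<close> with representative
  \<open>rep C\<close>, a finite transducer moves to \<open>C #> n\<close> and emits a word for the Schreier generator
  \<open>rep C \<otimes> n \<otimes> inv (rep (C #> n))\<close>.\<close>

lemma exists_schreier_rewriting:
  assumes H: "subgroup H G" and fin: "finite (rcosets H)"
    and gensH: "generated_group (G\<lparr>carrier := H\<rparr>) gensH"
  shows "\<exists>T :: nat list \<Rightarrow> bool \<times> nat list. computable T \<and> (\<forall>w \<in> nat_words gens.
    snd (T w) \<in> nat_words gensH \<and> (fst (T w) \<longleftrightarrow> val w \<in> H) \<and>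
    (val w \<in> H \<longrightarrow> nat_word_value (G\<lparr>carrier := H\<rparr>) gensH (snd (T w)) = val w))"
proof -
  interpret H: subgroup H G by fact
  interpret GH: generated_group "G\<lparr>carrier := H\<rparr>" gensH by fact
  let ?letter = "\<lambda>n. letter_value G gens (code_letter n)"
  \<comment> \<open>Cosets are numbered so that they can serve as states of a program.\<close>
  obtain idx :: "'a set \<Rightarrow> nat" where idx: "inj_on idx (rcosets H)"
    using finite_imp_inj_to_nat_seg[OF fin] by blast
  \<comment> \<open>The coset \<open>H\<close> gets the representative \<open>\<one>\<close>, so
    that nothing has to be cancelled at the start, nor at the end of a word with value in
    \<open>H\<close>.\<close>
  define rep where "rep C = (if C = H then \<one> else SOME x. x \<in> C)" for C
  have rep: "rep (H #> x) \<in> carrier G" "H #> rep (H #> x) = H #> x" if x: "x \<in> carrier G" for x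
  proof -
    have "rep (H #> x) \<in> H #> x"
    proof (cases "H #> x = H")
      case False
      then show ?thesis
        using someI[of "\<lambda>y. y \<in> H #> x" x] rcos_self[OF x H] by (simp add: rep_def)
    qed (simp add: rep_def)
    then show "rep (H #> x) \<in> carrier G" "H #> rep (H #> x) = H #> x"
      using repr_independence[OF _ x H] r_coset_subset_G[OF H.subset x] by auto
  qed
  \<comment> \<open>Multiplying \<open>rep C\<close> by the letter gives an element of the coset of
    \<open>rep (C #> ?letter n)\<close>, so the quotient lies in \<open>H\<close> and is spelled by
    some word.\<close>
  have "\<exists>u \<in> nat_words gensH. GH.val u = rep C \<otimes> ?letter n \<otimes> inv (rep (C #> ?letter n))"
    if C: "C \<in> rcosets H" and n: "n < 2 * length gens" for C n
  proof -
    obtain x where x: "x \<in> carrier G" "C = H #> x"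
      using C by (auto simp: RCOSETS_def)
    have n': "?letter n \<in> carrier G"
      by (rule letter_value_closed[OF n])
    then have Cn: "C #> ?letter n = H #> (x \<otimes> ?letter n)"
      using x coset_mult_assoc[OF H.subset] by simp
    have "H #> (rep C \<otimes> ?letter n) = H #> rep (C #> ?letter n)"
    proof -
      have "H #> (rep C \<otimes> ?letter n) = H #> rep C #> ?letter n"
        using rep(1)[OF x(1)] x(2) n' by (intro coset_mult_assoc[OF H.subset, symmetric]) auto
      also have "\<dots> = H #> (x \<otimes> ?letter n)"
        unfolding x(2) rep(2)[OF x(1)] using Cn x(2) by simp
      also have "\<dots> = H #> rep (C #> ?letter n)"
        unfolding Cn by (rule rep(2)[symmetric]) (use x(1) n' in simp)
      finally show ?thesis .
    qed
    then have "rep C \<otimes> ?letter n \<in> H #> rep (C #> ?letter n)"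
      using rep[OF x(1)] x(2) n' by (intro repr_independenceD[OF H]) auto
    then have "rep C \<otimes> ?letter n \<otimes> inv (rep (C #> ?letter n)) \<in> H"
      using rep[of "x \<otimes> ?letter n"] x(1) n' by (intro H.rcos_module_imp[OF is_group]) (auto simp: Cn)
    then show ?thesis
      using GH.exists_word by simp
  qed
  then obtain u where u: "\<And>C n. C \<in> rcosets H \<Longrightarrow> n < 2 * length gens \<Longrightarrow> u C n \<in> nat_words gensH \<and>
      GH.val (u C n) = rep C \<otimes> ?letter n \<otimes> inv (rep (C #> ?letter n))"
    by metis
  \<comment> \<open>The transition table, indexed by coset number and letter. The choices of
    \<open>idx\<close>, \<open>rep\<close> and \<open>u\<close> are not effective, but only finitely
    many entries differ from the default.\<close>
  define tab where "tab p = (if p \<in> idx ` (rcosets H) \<times> {..<2 * length gens}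
    then let C = inv_into (rcosets H) idx (fst p)
      in (idx (C #> ?letter (snd p)), u C (snd p))
    else (0, []))" for p
  have tab: "tab (idx C, n) = (idx (C #> ?letter n), u C n)"
    if "C \<in> rcosets H" "n < 2 * length gens" for C n
    using that idx by (simp add: tab_def)
  \<comment> \<open>The state holds the number of the current coset and the output so far.\<close>
  define run where "run w = foldl (\<lambda>s n. (fst (tab (fst s, n)), snd s @ snd (tab (fst s, n))))
    (idx H, []) w" for w
  have computable_tab: "computable tab"
    unfolding tab_def using fin by (intro computable_finite_support) simp
  have "computable (\<lambda>w. (fst (run w) = idx H, snd (run w)))"
    unfolding run_def
    by (intro computable_intros computable_foldl computable_compose[OF computable_tab])
  \<comment> \<open>Invariant: the value of the output times the representative of the current coset
    is the value of the word read.\<close>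
  moreover have run: "fst (run w) = idx (H #> val w) \<and> snd (run w) \<in> nat_words gensH \<and>
      GH.val (snd (run w)) \<otimes> rep (H #> val w) = val w" if "w \<in> nat_words gens" for w
    using that
  proof (induction w rule: rev_induct)
    case Nil
    show ?case
      using H.subset by (simp add: run_def rep_def)
  next
    case (snoc n w)
    then have w: "w \<in> nat_words gens" and n: "n < 2 * length gens" by auto
    let ?C = "H #> val w"
    have n': "?letter n \<in> carrier G"
      by (rule letter_value_closed[OF n])
    have C: "?C \<in> rcosets H"
      using w by (intro rcosetsI[OF H.subset]) simp
    have val: "val (w @ [n]) = val w \<otimes> ?letter n"
      using w n n' by (simp add: nat_word_value_Cons)
    then have Cn: "?C #> ?letter n = H #> val (w @ [n])"
      using w n' coset_mult_assoc[OF H.subset] by simp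
    have "run (w @ [n]) = (idx (H #> val (w @ [n])), snd (run w) @ u ?C n)"
      using snoc.IH[OF w] tab[OF C n] Cn by (simp add: run_def)
    moreover have "GH.val (snd (run w) @ u ?C n) \<otimes> rep (H #> val (w @ [n])) = val (w @ [n])"
    proof -
      have [simp]: "GH.val (snd (run w)) \<in> carrier G" "rep ?C \<in> carrier G"
        "rep (H #> val (w @ [n])) \<in> carrier G"
        using snoc.IH[OF w] GH.val_closed[of "snd (run w)"] rep(1) snoc.prems w by auto
      have "GH.val (snd (run w) @ u ?C n) = GH.val (snd (run w)) \<otimes> (rep ?C \<otimes> ?letter n \<otimes>
          inv (rep (H #> val (w @ [n]))))"
        using snoc.IH[OF w] u[OF C n] by (simp add: Cn)
      \<comment> \<open>The inverse at the end of the new Schreier generator cancels against the new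
        representative.\<close>
      then have "GH.val (snd (run w) @ u ?C n) \<otimes> rep (H #> val (w @ [n])) =
          GH.val (snd (run w)) \<otimes> (rep ?C \<otimes> ?letter n)"
        using n' by (simp add: m_assoc)
      also have "\<dots> = GH.val (snd (run w)) \<otimes> rep ?C \<otimes> ?letter n"
        by (rule m_assoc[symmetric]) (simp_all add: n')
      also have "\<dots> = val (w @ [n])"
        using snoc.IH[OF w] val by simp
      finally show ?thesis .
    qed
    ultimately show ?case
      using snoc.IH[OF w] u[OF C n] by simp
  qed
  \<comment> \<open>As \<open>idx\<close> is injective on cosets, the final state decides membership
    in \<open>H\<close>.\<close>
  moreover have "fst (run w) = idx H \<longleftrightarrow> val w \<in> H" if w: "w \<in> nat_words gens" for w
  proof -
    have "H #> val w \<in> rcosets H" "H \<in> rcosets H"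
      using w rcosetsI[OF H.subset, of "val w"] rcosetsI[OF H.subset, of \<one>] H.subset by auto
    then have "fst (run w) = idx H \<longleftrightarrow> H #> val w = H"
      using run[OF w] idx by (simp add: inj_on_eq_iff)
    then show ?thesis
      using coset_join1[OF _ val_closed[OF w] H] coset_join2[OF val_closed[OF w] H] by blast
  qed
  moreover have "GH.val (snd (run w)) = val w" if "w \<in> nat_words gens" "val w \<in> H" for w
  proof -
    have "rep (H #> val w) = \<one>"
      using coset_join2[OF val_closed[OF that(1)] H that(2)] by (simp add: rep_def)
    moreover have "GH.val (snd (run w)) \<in> carrier G"
      using run[OF that(1)] GH.val_closed[of "snd (run w)"] by auto
    ultimately show ?thesis
      using run[OF that(1)] by simp
  qed
  ultimately show ?thesis
    by (intro exI[of _ "\<lambda>w. (fst (run w) = idx H, snd (run w))"]) simp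
qed

section \<open>Transfer of decidability in both directions\<close>

lemma knapsack_decidable_subgroup:
  assumes H: "subgroup H G" and gensH: "generated_group (G\<lparr>carrier := H\<rparr>) gensH"
    and dec: "knapsack_decidable G gens"
  shows "knapsack_decidable (G\<lparr>carrier := H\<rparr>) gensH"
proof -
  interpret H: subgroup H G by fact
  interpret GH: generated_group "G\<lparr>carrier := H\<rparr>" gensH by fact
  obtain Q where Q: "computable Q" "\<And>ws w. ws \<in> lists (nat_words gens) \<Longrightarrow> w \<in> nat_words gens \<Longrightarrow>
      Q (ws, w) = nat_knapsack G gens (ws, w)"
    using dec knapsack_decidable_iff by blast
  let ?letter = "\<lambda>n. letter_value (G\<lparr>carrier := H\<rparr>) gensH (code_letter n)"
  have "\<exists>u \<in> nat_words gens. val u = ?letter n" if "n < 2 * length gensH" for n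
    using GH.letter_value_closed[OF that] by (intro exists_word) auto
  then obtain u where u: "\<And>n. n < 2 * length gensH \<Longrightarrow> u n \<in> nat_words gens \<and> val (u n) = ?letter n"
    by metis
  \<comment> \<open>Substitution of the fixed words \<open>u n\<close>. Erasing letters out of range
    makes it a finite table with default \<open>[]\<close>.\<close>
  define tr where "tr w = concat (map (\<lambda>n. if n \<in> {..<2 * length gensH} then u n else []) w)" for w
  have tr: "tr w \<in> nat_words gens \<and> val (tr w) = GH.val w" if "w \<in> nat_words gensH" for w
    using that by (induction w) (auto simp: tr_def u nat_word_value_Cons)
  have "computable (\<lambda>x. Q (map tr (fst x), tr (snd x)))"
    unfolding tr_def
    by (intro computable_compose[OF Q(1)] computable_intros
        computable_compose[OF computable_finite_support]) auto
  moreover have "Q (map tr ws, tr w) = nat_knapsack (G\<lparr>carrier := H\<rparr>) gensH (ws, w)"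
    if ws: "ws \<in> lists (nat_words gensH)" and w: "w \<in> nat_words gensH" for ws w
  proof -
    have "map tr ws \<in> lists (nat_words gens)" and "map val (map tr ws) = map GH.val ws"
      using ws tr by auto
    then show ?thesis
      using Q(2) tr[OF w]
      by (simp add: nat_knapsack_def knapsack_solvable_consistent del: map_map in_lists_conv_set)
  qed
  ultimately show ?thesis
    unfolding knapsack_decidable_iff by (intro exI[of _ "\<lambda>x. Q (map tr (fst x), tr (snd x))"]) simp
qed

text \<open>The program tries every candidate: it tests whether the target times
  \<open>inv (val p)\<close> lies in \<open>H\<close> and, if so, asks the procedure for
  \<open>H\<close> about the rewritten instance.\<close>

lemma knapsack_decidable_overgroup:
  assumes H: "subgroup H G" and fin: "finite (rcosets H)"
    and gensH: "generated_group (G\<lparr>carrier := H\<rparr>) gensH"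
    and dec: "knapsack_decidable (G\<lparr>carrier := H\<rparr>) gensH"
  shows "knapsack_decidable G gens"
proof -
  interpret H: subgroup H G by fact
  interpret GH: generated_group "G\<lparr>carrier := H\<rparr>" gensH by fact
  obtain Q where Q: "computable Q" "\<And>ws w. ws \<in> lists (nat_words gensH) \<Longrightarrow> w \<in> nat_words gensH \<Longrightarrow>
      Q (ws, w) = nat_knapsack (G\<lparr>carrier := H\<rparr>) gensH (ws, w)"
    using dec knapsack_decidable_iff by blast
  obtain T :: "nat list \<Rightarrow> bool \<times> nat list" where T: "computable T"
    "\<And>w. w \<in> nat_words gens \<Longrightarrow> snd (T w) \<in> nat_words gensH"
    "\<And>w. w \<in> nat_words gens \<Longrightarrow> fst (T w) \<longleftrightarrow> val w \<in> H"
    "\<And>w. w \<in> nat_words gens \<Longrightarrow> val w \<in> H \<Longrightarrow> GH.val (snd (T w)) = val w"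
    using exists_schreier_rewriting[OF H fin gensH] by blast
  obtain d :: nat where d: "d > 0" "\<And>g. g \<in> carrier G \<Longrightarrow> g [^] d \<in> H"
    using finite_index_exponent[OF H fin] by blast
  define R where "R x = (\<exists>c \<in> set (candidates d (fst x)). fst (T (snd x @ inverse_word gens (snd c))) \<and>
    Q (map (\<lambda>h. snd (T h)) (fst c), snd (T (snd x @ inverse_word gens (snd c)))))" for x
  have "computable R"
    unfolding R_def
    by (intro computable_intros computable_compose[OF Q(1)] computable_compose[OF T(1)])
  moreover have "R (ws, w) \<longleftrightarrow> nat_knapsack G gens (ws, w)"
    if ws: "ws \<in> lists (nat_words gens)" and w: "w \<in> nat_words gens" for ws w
  proof -
    have "fst (T (w @ inverse_word gens p)) \<and>
        Q (map (\<lambda>h. snd (T h)) hs, snd (T (w @ inverse_word gens p))) \<longleftrightarrow>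
      (\<exists>s. knapsack_solvable G (map val hs) s \<and> val w = s \<otimes> val p)" (is "?L \<longleftrightarrow> ?R")
      if c: "(hs, p) \<in> set (candidates d ws)" for hs p
    proof -
      have hs: "hs \<in> lists (nat_words gens)" and p: "p \<in> nat_words gens"
        using candidates_in_nat_words[OF ws c] by auto
      have hs_H: "val h \<in> H" if "h \<in> set hs" for h
        using candidates_in_subgroup[OF ws c that] d(2) by auto
      let ?v = "w @ inverse_word gens p"
      have v: "?v \<in> nat_words gens" "val ?v = val w \<otimes> inv (val p)"
        using w p by (simp_all add: inverse_word_in_nat_words)
      have hs': "map (\<lambda>h. snd (T h)) hs \<in> lists (nat_words gensH)"
        using hs T(2) by auto
      have map_hs: "map GH.val (map (\<lambda>h. snd (T h)) hs) = map val hs"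
        using hs hs_H T(4) by auto
      have "?L \<longleftrightarrow> val ?v \<in> H \<and> knapsack_solvable G (map val hs) (val ?v)"
        using Q(2)[OF hs' T(2)[OF v(1)]] T(3,4)[OF v(1)] map_hs
        by (auto simp: nat_knapsack_def knapsack_solvable_consistent simp del: map_map)
      \<comment> \<open>Every product of powers of the \<open>val h\<close> lies in
        \<open>H\<close>, so solvability already implies the membership test.\<close>
      also have "\<dots> \<longleftrightarrow> knapsack_solvable G (map val hs) (val ?v)"
        using GH.knapsack_solvable_closed[of "map val hs"] hs_H
        by (auto simp: knapsack_solvable_consistent)
      also have "\<dots> \<longleftrightarrow> ?R"
      proof -
        have "val w = s \<otimes> val p \<longleftrightarrow> s = val w \<otimes> inv (val p)" if "s \<in> carrier G" for s
          using that w p inv_solve_right[of s "val w" "val p"] by auto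
        moreover have "set (map val hs) \<subseteq> carrier G"
          using hs by auto
        note knapsack_solvable_closed[OF this]
        ultimately show ?thesis
          using v(2) by auto
      qed
      finally show ?thesis .
    qed
    then show ?thesis
      unfolding R_def nat_knapsack_def prod.case knapsack_solvable_iff_candidates[OF ws d(1)]
        fst_conv snd_conv
      by (intro bex_cong[OF refl]) (simp add: case_prod_unfold)
  qed
  ultimately show ?thesis
    unfolding knapsack_decidable_iff by blast
qed

end

theorem theorem7p3:
  fixes G (structure) and H :: "'a set" and gensG gensH :: "'a list"
  assumes "group G"
    and "generating_list G gensG"
    and "subgroup H G"
    and "finite (rcosets H)"
    and "generating_list (G\<lparr>carrier := H\<rparr>) gensH"
  shows "knapsack_decidable G gensG \<longleftrightarrow> knapsack_decidable (G\<lparr>carrier := H\<rparr>) gensH"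
proof -
  interpret generated_group G gensG
    by (simp add: generated_group_def generated_group_axioms_def assms)
  have "generated_group (G\<lparr>carrier := H\<rparr>) gensH"
    by (simp add: generated_group_def generated_group_axioms_def assms subgroup_imp_group)
  then show ?thesis
    using knapsack_decidable_subgroup knapsack_decidable_overgroup assms(3,4) by blast
qed

end
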